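(* There exist a real number $b > 1$ and a sequence $(P_j)_{j \in \mathbb{N}}$ of discrete Borel probability measures on $\mathbb{R}$ with support contained in $[1, b]$ such that for every $j \in \mathbb{N}$: $P_j \prec_{\text{tail}} P_{j+1}$, the probability mass functions of $P_j$ and $P_{j+1}$ alternate on $[1, b]$, and the (cumulative) distribution functions of $P_j$ and $P_{j+1}$ alternate on $[1, b]$.
   Context: Two functions $f, g: \mathbb{R} \to \mathbb{R}$ alternate on an interval $[a, b]$ if for every $x_0 \in (a, b)$ there are $x_1, x_2 \in (x_0, b)$ such that $f(x_1) < g(x_1)$ and $f(x_2) > g(x_2)$. The mass function of a discrete measure $P$ is $x \mapsto P(\{x\})$; its distribution function is $x \mapsto P((-\infty, x])$. For Borel probability measures $P$ on $\mathbb{R}$ having moments of all orders, let $m_k(P) = \int x^k \, dP(x)$, $k \in \mathbb{N}_0$. The stochastic tail order: $P \preccurlyeq_{\text{tail}} Q$ iff $P = Q$, or ($P, Q$ have moments of all orders and $m_k(P) \leq m_k(Q)$ for all but finitely many $k \in \mathbb{N}_0$). $P \prec_{\text{tail}} Q$ means $P \preccurlyeq_{\text{tail}} Q$ and not $Q \preccurlyeq_{\text{tail}} P$. *)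

theory Defs
  imports "HOL-Probability.Probability"
begin

definition alternate_on :: "real \<Rightarrow> real \<Rightarrow> (real \<Rightarrow> real) \<Rightarrow> (real \<Rightarrow> real) \<Rightarrow> bool" where
  "alternate_on a b f g \<longleftrightarrow>
     (\<forall>x0\<in>{a<..<b}. \<exists>x1\<in>{x0<..<b}. \<exists>x2\<in>{x0<..<b}. f x1 < g x1 \<and> f x2 > g x2)"

definition discrete_measure :: "real measure \<Rightarrow> bool" where
  "discrete_measure P \<longleftrightarrow> (\<exists>S. countable S \<and> emeasure P (- S) = 0)"

text \<open>The topological support; it is the smallest closed set of full measure.\<close>
definition measure_support :: "real measure \<Rightarrow> real set" where
  "measure_support P = {x. \<forall>U. open U \<and> x \<in> U \<longrightarrow> emeasure P U > 0}"

definition mass_function :: "real measure \<Rightarrow> real \<Rightarrow> real" where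
  "mass_function P x = measure P {x}"

definition has_all_moments :: "real measure \<Rightarrow> bool" where
  "has_all_moments P \<longleftrightarrow> (\<forall>k::nat. integrable P (\<lambda>x. x ^ k))"

definition moment :: "nat \<Rightarrow> real measure \<Rightarrow> real" where
  "moment k P = (LINT x|P. x ^ k)"

text \<open>The next two relations are meant for Borel probability measures on the reals, that is,
  for measures satisfying \<^term>\<open>real_distribution\<close>.\<close>
definition tail_le :: "real measure \<Rightarrow> real measure \<Rightarrow> bool" where
  "tail_le P Q \<longleftrightarrow> P = Q \<or>
     (has_all_moments P \<and> has_all_moments Q \<and>
      (\<forall>\<^sub>\<infinity>k. moment k P \<le> moment k Q))"

definition tail_less :: "real measure \<Rightarrow> real measure \<Rightarrow> bool" where
  "tail_less P Q \<longleftrightarrow> tail_le P Q \<and> \<not> tail_le Q P"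

end

theory Submission imports Defs
begin

text \<open>Spreading a random variable symmetrically about its conditional mean increases all moments of
  order at least two, since powers are convex on the positive reals.  Put mass on infinitely many
  pairs of points, the \<open>n\<close>-th pair being symmetric about \<open>5 - 3 / 2 ^ n\<close>, and let \<open>P\<^sub>j\<^sub>+\<^sub>1\<close> arise
  from \<open>P\<^sub>j\<close> by widening every pair.  Within the \<open>n\<close>-th pair the new distribution function is larger
  to the left of the centre and smaller to the right of it, while to the left and to the right of the
  widened pair nothing changes.  Since the pairs accumulate at \<open>5\<close>, the distribution functions
  alternate, although all moments increase.\<close>

definition spread :: "nat \<Rightarrow> real" where
  "spread j = real j / (real j + 1)"

text \<open>The index set does not depend on \<open>j\<close>; only the positions move. As
  \<open>spread 0 = 0\<close>, the two points of each pair coincide for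
  \<open>j = 0\<close>.\<close>

definition site :: "nat \<Rightarrow> nat \<times> bool \<Rightarrow> real" where
  "site j = (\<lambda>(n, left). 5 - (3 + (if left then spread j else - spread j)) * (1/2) ^ n)"

text \<open>Two features of these weights carry the proof: every index has positive probability, and
  the two sides of a pair are equally likely.\<close>

definition index_pmf :: "(nat \<times> bool) pmf" where
  "index_pmf = pair_pmf (geometric_pmf (1/2)) (pmf_of_set UNIV)"

definition spread_law :: "nat \<Rightarrow> real measure" where
  "spread_law j = distr (measure_pmf index_pmf) borel (site j)"

section \<open>Position and order of the points\<close>

lemma spread_nonneg: "0 \<le> spread j"
  and spread_less_1: "spread j < 1"
  and spread_less_Suc: "spread j < spread (Suc j)"
  by (auto simp: spread_def field_simps)

text \<open>Because \<open>spread\<close> stays in [0, 1), the distances of the \<open>n\<close>-th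
  pair from 5 lie strictly between 2 / 2^n and 4 / 2^n. These ranges are disjoint for different
  \<open>n\<close>, so pairs never overlap, even between different laws.\<close>

lemma site_less:
  assumes "m < n"
  shows "site i (m, b) < site j (n, c)"
proof -
  have le: "(1/2::real) ^ n \<le> (1/2) ^ Suc m"
    using assms by (intro power_decreasing) auto
  have lo: "2 < 3 + (if b then spread i else - spread i)"
    using spread_less_1[of i] spread_nonneg[of i] by auto
  have hi: "3 + (if c then spread j else - spread j) < 4"
    using spread_less_1[of j] spread_nonneg[of j] by auto
  have "(3 + (if c then spread j else - spread j)) * (1/2) ^ n < 4 * (1/2) ^ n"
    using hi by (intro mult_strict_right_mono) auto
  also have "\<dots> \<le> 2 * (1/2) ^ m"
    using le by simp
  also have "\<dots> < (3 + (if b then spread i else - spread i)) * (1/2) ^ m"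
    using lo by (intro mult_strict_right_mono) auto
  finally show ?thesis
    by (simp add: site_def)
qed

lemma site_le_iff:
  "site i (n, b) \<le> site j (n, c) \<longleftrightarrow>
     (if c then spread j else - spread j) \<le> (if b then spread i else - spread i)"
  by (simp add: site_def)

lemma site_bounds: "5 - 4 * (1/2) ^ n < site j (n, b)" "site j (n, b) < 5"
proof -
  have "(3 + (if b then spread j else - spread j)) * (1/2) ^ n < 4 * (1/2) ^ n"
    using spread_less_1[of j] spread_nonneg[of j] by (intro mult_strict_right_mono) auto
  then show "5 - 4 * (1/2) ^ n < site j (n, b)"
    by (simp add: site_def)
  have "0 < (3 + (if b then spread j else - spread j)) * (1/2) ^ n"
    using spread_less_1[of j] spread_nonneg[of j] by (intro mult_pos_pos) auto
  then show "site j (n, b) < 5"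
    by (simp add: site_def)
qed

lemma site_in_interval: "1 < site j \<omega> \<and> site j \<omega> < 5"
proof (cases \<omega>)
  case (Pair n b)
  have "(1/2::real) ^ n \<le> 1"
    by (simp add: power_le_one)
  then show ?thesis
    using site_bounds(1)[of n j b] site_bounds(2)[of j n b] Pair by auto
qed

text \<open>The new left point of pair \<open>n\<close> lies to the left of the whole old pair. So
  exactly the index \<open>(n, True)\<close> is gained there in passing from \<open>j\<close> to
  \<open>Suc j\<close>.\<close>

lemma site_le_left_iff:
  "site j (m, b) \<le> site (Suc j) (n, True) \<longleftrightarrow> m < n"
  "site (Suc j) (m, b) \<le> site (Suc j) (n, True) \<longleftrightarrow> m < n \<or> m = n \<and> b"
  using site_less[of m n j b "Suc j" True] site_less[of n m "Suc j" True j b]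
    site_less[of m n "Suc j" b "Suc j" True] site_less[of n m "Suc j" True "Suc j" b]
    spread_less_Suc[of j] spread_nonneg[of j]
  by (cases m n rule: linorder_cases; cases b; force simp: site_le_iff)+

text \<open>At the old right point of pair \<open>n\<close> the whole old pair is counted, but the
  new right point has moved beyond it. So exactly the index \<open>(n, False)\<close> is
  lost.\<close>

lemma site_le_right_iff:
  "site j (m, b) \<le> site j (n, False) \<longleftrightarrow> m \<le> n"
  "site (Suc j) (m, b) \<le> site j (n, False) \<longleftrightarrow> m < n \<or> m = n \<and> b"
  using site_less[of m n j b j False] site_less[of n m j False j b]
    site_less[of m n "Suc j" b j False] site_less[of n m j False "Suc j" b]
    spread_less_Suc[of j] spread_nonneg[of j]
  by (cases m n rule: linorder_cases; cases b; force simp: site_le_iff)+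

text \<open>This and \<open>site_neq_right\<close> make one of the two mass functions vanish at each
  test point, where the other has an atom.\<close>

lemma site_neq_left: "site j \<omega> \<noteq> site (Suc j) (n, True)"
proof (cases \<omega>)
  case (Pair m b)
  then show ?thesis
    using site_less[of m n j b "Suc j" True] site_le_left_iff(1)[of j m b n] by force
qed

lemma site_neq_right: "site (Suc j) \<omega> \<noteq> site j (n, False)"
proof (cases \<omega>)
  case (Pair m b)
  then show ?thesis
    using site_less[of m n "Suc j" b j False] site_less[of n m j False "Suc j" b]
      site_le_iff[of "Suc j" n b j False] site_le_iff[of j n False "Suc j" b] spread_less_Suc[of j] spread_nonneg[of j]
    by (cases m n rule: linorder_cases; cases b) auto
qed

section \<open>The index law and its images\<close>

lemma set_index_pmf: "set_pmf index_pmf = UNIV"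
  by (simp add: index_pmf_def set_pmf_of_set set_pmf_geometric)

lemma map_index_pmf_flip: "map_pmf (\<lambda>(n, b). (n, \<not> b)) index_pmf = index_pmf"
proof -
  have "bij Not"
    by (intro o_bij[of Not]) auto
  then have "map_pmf Not (pmf_of_set UNIV) = pmf_of_set UNIV"
    by (intro map_pmf_of_set_bij_betw) auto
  then show ?thesis
    using map_pair[of id Not "geometric_pmf (1/2)" "pmf_of_set UNIV"]
    by (simp add: index_pmf_def map_pmf_id)
qed

text \<open>All laws are images of one index law, so their masses and distribution functions are
  compared through inclusions of index sets. One extra index then yields strictness.\<close>

lemma measure_pmf_strict_mono:
  assumes "set_pmf p = UNIV" "A \<subseteq> B" "x \<in> B" "x \<notin> A"
  shows "measure_pmf.prob p A < measure_pmf.prob p B"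
proof -
  have "measure_pmf.prob p A < measure_pmf.prob p A + pmf p x"
    using assms(1) by (simp add: pmf_positive)
  also have "\<dots> = measure_pmf.prob p (insert x A)"
    using assms(4) measure_pmf.finite_measure_Union[of A p "{x}"] by (simp add: measure_pmf_single)
  also have "\<dots> \<le> measure_pmf.prob p B"
    using assms(2,3) by (intro measure_pmf.finite_measure_mono) auto
  finally show ?thesis .
qed

lemma measure_spread_law:
  "A \<in> sets borel \<Longrightarrow> measure (spread_law j) A = measure_pmf.prob index_pmf {\<omega>. site j \<omega> \<in> A}"
  by (simp add: spread_law_def measure_distr vimage_def)

lemma emeasure_spread_law:
  "A \<in> sets borel \<Longrightarrow> emeasure (spread_law j) A = emeasure (measure_pmf index_pmf) {\<omega>. site j \<omega> \<in> A}"
  by (simp add: spread_law_def emeasure_distr vimage_def)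

lemma real_distribution_spread_law: "real_distribution (spread_law j)"
  unfolding spread_law_def by (intro prob_space.real_distribution_distr prob_space_measure_pmf) simp

lemma discrete_measure_spread_law: "discrete_measure (spread_law j)"
  unfolding discrete_measure_def
proof (intro exI conjI)
  show *: "countable (range (site j))"
    by simp
  have "range (site j) \<in> sets borel"
    by (intro sets.countable[OF _ *]) auto
  then show "emeasure (spread_law j) (- range (site j)) = 0"
    by (subst emeasure_spread_law) auto
qed

lemma measure_support_spread_law: "measure_support (spread_law j) \<subseteq> {1..5}"
proof
  fix x
  assume x: "x \<in> measure_support (spread_law j)"
  have "emeasure (spread_law j) (- {1..5}) = 0"
    using site_in_interval[of j] by (subst emeasure_spread_law) (auto simp: less_imp_le simp del: split_paired_All)
  moreover have "open (- {1..5::real})"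
    by (simp add: open_Compl)
  ultimately show "x \<in> {1..5}"
    using x unfolding measure_support_def by (metis (mono_tags) ComplI less_irrefl mem_Collect_eq)
qed

section \<open>Alternation\<close>

lemma alternate_on_spreadI:
  assumes "\<And>n. f (site (Suc j) (n, True)) < g (site (Suc j) (n, True))"
    and "\<And>n. g (site j (n, False)) < f (site j (n, False))"
  shows "alternate_on 1 5 f g"
  unfolding alternate_on_def
proof
  fix x0 :: real
  assume "x0 \<in> {1<..<5}"
  \<comment> \<open>With 4 / 2^n < 5 - x0, the whole \<open>n\<close>-th pair of every law lies in
    (x0, 5). Its new left point and old right point serve as x1 and x2.\<close>
  then obtain n where "(1/2) ^ n < (5 - x0) / 4"
    using real_arch_pow_inv[of "(5 - x0) / 4" "1/2"] by auto
  then have "x0 < site i (n, b)" for i b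
    using site_bounds(1)[of n i b] by simp
  then show "\<exists>x1\<in>{x0<..<5}. \<exists>x2\<in>{x0<..<5}. f x1 < g x1 \<and> f x2 > g x2"
    using assms[of n] site_bounds(2)[of _ n]
    by (intro bexI[of _ "site (Suc j) (n, True)"] bexI[of _ "site j (n, False)"]) auto
qed

lemma mass_function_spread_law_alternate:
  "alternate_on 1 5 (mass_function (spread_law j)) (mass_function (spread_law (Suc j)))"
proof (rule alternate_on_spreadI[of _ j])
  fix n
  have "measure_pmf.prob index_pmf {\<omega>. site j \<omega> \<in> {site (Suc j) (n, True)}}
      < measure_pmf.prob index_pmf {\<omega>. site (Suc j) \<omega> \<in> {site (Suc j) (n, True)}}"
    by (rule measure_pmf_strict_mono[OF set_index_pmf, where x = "(n, True)"])
      (simp_all add: site_neq_left del: split_paired_All)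
  then show "mass_function (spread_law j) (site (Suc j) (n, True))
      < mass_function (spread_law (Suc j)) (site (Suc j) (n, True))"
    by (simp only: mass_function_def measure_spread_law borel_singleton sets.empty_sets)
  have "measure_pmf.prob index_pmf {\<omega>. site (Suc j) \<omega> \<in> {site j (n, False)}}
      < measure_pmf.prob index_pmf {\<omega>. site j \<omega> \<in> {site j (n, False)}}"
    by (rule measure_pmf_strict_mono[OF set_index_pmf, where x = "(n, False)"])
      (simp_all add: site_neq_right del: split_paired_All)
  then show "mass_function (spread_law (Suc j)) (site j (n, False))
      < mass_function (spread_law j) (site j (n, False))"
    by (simp only: mass_function_def measure_spread_law borel_singleton sets.empty_sets)
qed

lemma cdf_spread_law_alternate:
  "alternate_on 1 5 (cdf (spread_law j)) (cdf (spread_law (Suc j)))"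
proof (rule alternate_on_spreadI[of _ j])
  fix n
  have "measure_pmf.prob index_pmf {\<omega>. site j \<omega> \<le> site (Suc j) (n, True)}
      < measure_pmf.prob index_pmf {\<omega>. site (Suc j) \<omega> \<le> site (Suc j) (n, True)}"
    by (rule measure_pmf_strict_mono[OF set_index_pmf, where x = "(n, True)"])
      (auto simp: site_le_left_iff)
  then show "cdf (spread_law j) (site (Suc j) (n, True))
      < cdf (spread_law (Suc j)) (site (Suc j) (n, True))"
    by (simp add: cdf_def measure_spread_law)
  have "measure_pmf.prob index_pmf {\<omega>. site (Suc j) \<omega> \<le> site j (n, False)}
      < measure_pmf.prob index_pmf {\<omega>. site j \<omega> \<le> site j (n, False)}"
    by (rule measure_pmf_strict_mono[OF set_index_pmf, where x = "(n, False)"])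
      (auto simp: site_le_right_iff)
  then show "cdf (spread_law (Suc j)) (site j (n, False))
      < cdf (spread_law j) (site j (n, False))"
    by (simp add: cdf_def measure_spread_law)
qed

section \<open>Growth of the moments\<close>

lemma symmetric_power_sum_strict_mono:
  fixes q s t :: real
  assumes "0 \<le> s" "s < t" "t < q"
  shows "(q + s) ^ (k + 2) + (q - s) ^ (k + 2) < (q + t) ^ (k + 2) + (q - t) ^ (k + 2)"
proof -
  \<comment> \<open>Multiplying out one factor q + s or q - s couples sums and differences of powers
    in a recurrence with nonnegative coefficients, which allows a joint induction.\<close>
  define f g :: "real \<Rightarrow> nat \<Rightarrow> real"
    where "f = (\<lambda>s k. (q + s) ^ k + (q - s) ^ k)" and "g = (\<lambda>s k. (q + s) ^ k - (q - s) ^ k)"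
  have f_Suc: "f s (Suc k) = q * f s k + s * g s k"
    and g_Suc: "g s (Suc k) = q * g s k + s * f s k" for s k
    by (simp_all add: f_def g_def algebra_simps)
  have f_pos: "0 < f s k" for k
    using assms by (simp add: f_def add_pos_pos)
  have g_nonneg: "0 \<le> g s k" for k
    using assms by (simp add: g_def power_mono)
  have q: "0 < q"
    using assms by simp
  \<comment> \<open>The induction starts at exponent 1, where both sums equal 2q, so only the
    differences can be strictly ordered.\<close>
  have *: "f s (Suc k) \<le> f t (Suc k) \<and> g s (Suc k) < g t (Suc k)" for k
  proof (induction k)
    case 0
    then show ?case
      using assms by (simp add: f_def g_def)
  next
    case (Suc k)
    have "s * f s (Suc k) \<le> t * f t (Suc k)" "s * g s (Suc k) \<le> t * g t (Suc k)"
      using Suc assms f_pos[of "Suc k"] g_nonneg[of "Suc k"] by (auto intro!: mult_mono)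
    moreover have "q * f s (Suc k) \<le> q * f t (Suc k)" "q * g s (Suc k) < q * g t (Suc k)"
      using Suc q by auto
    ultimately show ?case
      by (subst (1 2) f_Suc, subst (1 2) g_Suc) linarith
  qed
  \<comment> \<open>One more use of the recurrence turns the strict order of the differences into a
    strict order of the sums.\<close>
  have "s * g s (Suc k) < t * g t (Suc k)"
    using *[of k] assms g_nonneg[of "Suc k"] by (intro mult_strict_mono') auto
  moreover have "q * f s (Suc k) \<le> q * f t (Suc k)"
    using *[of k] q by auto
  ultimately have "f s (Suc (Suc k)) < f t (Suc (Suc k))"
    by (subst (1 2) f_Suc) linarith
  then show ?thesis
    by (simp add: f_def)
qed

lemma norm_site_power_le: "norm (site j \<omega> ^ k) \<le> 5 ^ k"
  unfolding norm_power using site_in_interval[of j \<omega>] by (intro power_mono) auto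

lemma integrable_site_power: "integrable (measure_pmf index_pmf) (\<lambda>\<omega>. site j \<omega> ^ k)"
  by (rule measure_pmf.integrable_const_bound[OF AE_I2[OF norm_site_power_le]]) simp

lemma has_all_moments_spread_law: "has_all_moments (spread_law j)"
  unfolding has_all_moments_def spread_law_def
  by (simp add: integrable_distr_eq integrable_site_power)

lemma moment_spread_law:
  "moment k (spread_law j) = measure_pmf.expectation index_pmf (\<lambda>\<omega>. site j \<omega> ^ k)"
  unfolding moment_def spread_law_def by (simp add: integral_distr)

text \<open>Widening lowers the power at the left point, so the integrands
  \<open>site j \<omega> ^ k\<close> cannot be compared pointwise. Averaging over the
  measure-preserving swap of sides replaces them by pair sums, which can.\<close>

lemma moment_spread_law_symmetrized:
  "2 * moment k (spread_law j) =
     measure_pmf.expectation index_pmf (\<lambda>(n, b). site j (n, True) ^ k + site j (n, False) ^ k)"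
proof -
  let ?flip = "\<lambda>(n::nat, b). (n, \<not> b)"
  have flip: "measure_pmf.expectation index_pmf (\<lambda>\<omega>. site j (?flip \<omega>) ^ k) = moment k (spread_law j)"
    unfolding moment_spread_law
    by (subst (2) map_index_pmf_flip[symmetric]) (simp add: integral_map_pmf)
  have int: "integrable (measure_pmf index_pmf) (\<lambda>\<omega>. site j (?flip \<omega>) ^ k)"
    using integrable_site_power[of j k]
    by (subst (asm) map_index_pmf_flip[symmetric]) (simp add: integrable_map_pmf_eq)
  have "2 * moment k (spread_law j) =
      measure_pmf.expectation index_pmf (\<lambda>\<omega>. site j \<omega> ^ k + site j (?flip \<omega>) ^ k)"
    using Bochner_Integration.integral_add[OF integrable_site_power int] flip
    by (simp add: moment_spread_law)
  also have "\<dots> = measure_pmf.expectation index_pmf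
      (\<lambda>(n, b). site j (n, True) ^ k + site j (n, False) ^ k)"
    \<comment> \<open>The pair sum is the same for both values of the side.\<close>
    by (intro Bochner_Integration.integral_cong refl) (simp add: all_bool_eq split: prod.split)
  finally show ?thesis .
qed

lemma moment_spread_law_strict_mono:
  "moment (k + 2) (spread_law j) < moment (k + 2) (spread_law (Suc j))"
proof -
  let ?h = "\<lambda>j (n, b::bool). site j (n, True) ^ (k + 2) + site j (n, False) ^ (k + 2)"
  have int: "integrable (measure_pmf index_pmf) (?h j)" for j
  proof (rule measure_pmf.integrable_const_bound[where B = "5 ^ (k + 2) + 5 ^ (k + 2)"])
    show "AE \<omega> in measure_pmf index_pmf. norm (?h j \<omega>) \<le> 5 ^ (k + 2) + 5 ^ (k + 2)"
      by (rule AE_I2, simp only: split_beta)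
        (intro order_trans[OF norm_triangle_ineq] add_mono norm_site_power_le)
  qed simp
  have less: "?h j \<omega> < ?h (Suc j) \<omega>" for \<omega>
  proof (cases \<omega>)
    case (Pair n b)
    define v :: real where "v = (1/2) ^ n"
    have v: "0 < v" "v \<le> 1"
      by (auto simp: v_def power_le_one)
    have s: "0 \<le> spread j" "spread j < spread (Suc j)" "spread (Suc j) < 1"
      by (rule spread_nonneg spread_less_Suc spread_less_1)+
    \<comment> \<open>The power inequality is applied with centre q = 5 - 3v and half-widths
      \<open>spread j * v\<close> and \<open>spread (Suc j) * v\<close>. Since v \<le> 1, the centre
      is at least 2 and exceeds both.\<close>
    have "spread (Suc j) * v < 1 * 1"
      using v s by (intro mult_less_le_imp_less) auto
    then have "spread (Suc j) * v < 5 - 3 * v"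
      using v by linarith
    then have "(5 - 3 * v + spread j * v) ^ (k + 2) + (5 - 3 * v - spread j * v) ^ (k + 2)
        < (5 - 3 * v + spread (Suc j) * v) ^ (k + 2) + (5 - 3 * v - spread (Suc j) * v) ^ (k + 2)"
      using v s by (intro symmetric_power_sum_strict_mono) auto
    moreover have "site i (n, True) = 5 - 3 * v - spread i * v"
      "site i (n, False) = 5 - 3 * v + spread i * v" for i
      by (simp_all add: site_def v_def algebra_simps)
    ultimately show ?thesis
      using Pair by (simp only: prod.case)
  qed
  show ?thesis
    using measure_pmf.integral_less_AE_space[OF int int AE_I2[OF less]]
    unfolding moment_spread_law_symmetrized[symmetric] by (simp add: measure_pmf.emeasure_space_1)
qed

lemma tail_less_spread_law: "tail_less (spread_law j) (spread_law (Suc j))"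
proof -
  have less: "moment k (spread_law j) < moment k (spread_law (Suc j))" if "2 \<le> k" for k
    using moment_spread_law_strict_mono[of "k - 2" j] that by (simp only: le_add_diff_inverse2)
  then have "\<forall>\<^sub>\<infinity>k. moment k (spread_law j) \<le> moment k (spread_law (Suc j))"
    unfolding MOST_nat_le by (meson less_imp_le)
  \<comment> \<open>A threshold for the reverse inequality would be refuted at its maximum with
    2.\<close>
  moreover have "\<not> (\<forall>\<^sub>\<infinity>k. moment k (spread_law (Suc j)) \<le> moment k (spread_law j))"
    unfolding MOST_nat_le using less by (meson linorder_not_le max.cobounded1 max.cobounded2)
  moreover have "spread_law (Suc j) \<noteq> spread_law j"
    using less[of 2] by auto
  ultimately show ?thesis
    by (simp add: tail_less_def tail_le_def has_all_moments_spread_law)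
qed

theorem mainTheorem4:
  "\<exists>(b::real) (P :: nat \<Rightarrow> real measure). b > 1 \<and>
     (\<forall>j. real_distribution (P j) \<and> discrete_measure (P j) \<and> measure_support (P j) \<subseteq> {1..b}) \<and>
     (\<forall>j. tail_less (P j) (P (Suc j)) \<and>
          alternate_on 1 b (mass_function (P j)) (mass_function (P (Suc j))) \<and>
          alternate_on 1 b (cdf (P j)) (cdf (P (Suc j))))"
  by (rule exI[of _ 5], rule exI[of _ spread_law])
    (simp add: real_distribution_spread_law discrete_measure_spread_law measure_support_spread_law
      tail_less_spread_law mass_function_spread_law_alternate cdf_spread_law_alternate)

end
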